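(* For every integer $n$ with $4\le n\le 6$, the $n$-dimensional spined cube $SQ_n$ contains two edge-disjoint Hamiltonian cycles.
   Context: All graphs are finite, simple and undirected. A cycle is Hamiltonian if it contains every vertex of the graph; two Hamiltonian cycles are edge-disjoint if they have no common edge. The spined cube $SQ_n$ ($n\ge 1$) has as vertices the $2^n$ binary strings $x_1x_2\cdots x_n$ and is defined recursively. $SQ_1$ is the complete graph on the two vertices $0$ and $1$. For $n\ge 2$, $SQ_n$ consists of two copies $0SQ_{n-1}$ and $1SQ_{n-1}$ of $SQ_{n-1}$ (every vertex label prefixed by $0$, respectively by $1$), together with the edges joining each vertex $x=0x_2\cdots x_n$ of $0SQ_{n-1}$ to exactly one vertex $x'$ of $1SQ_{n-1}$, where (all sums of bits are modulo 2): $x'=1x_2$ if $n=2$; $x'=1(x_2+x_n)x_3\cdots x_n$ if $n=3$ or $4$; $x'=1(x_2+x_{n-1})(x_3+x_n)x_4\cdots x_n$ if $n\ge 5$. *)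

theory Defs
  imports "Graph_Theory.Pair_Digraph" "HOL-Library.Z2"
begin

text \<open>
  A finite simple undirected graph is a \<^locale>\<open>pair_graph\<close>: a finite loop-free symmetric digraph,
  in which the edge \<open>{u, v}\<close> is represented by the two arcs \<open>(u, v)\<close> and \<open>(v, u)\<close>.
  Vertices of the spined cube are strings over the two-element field \<^typ>\<open>bit\<close>, so \<open>+\<close> is addition
  modulo 2. List indices start at 0: the bit $x_i$ of $x_1 \ldots x_n$ is \<open>x ! (i - 1)\<close>.
\<close>

definition spine_mate :: "nat \<Rightarrow> bit list \<Rightarrow> bit list" where
  "spine_mate n x =
     (if n = 2 then [1, x ! 1]
      else if n = 3 \<or> n = 4 then 1 # (x ! 1 + x ! (n - 1)) # drop 2 x
      else 1 # (x ! 1 + x ! (n - 2)) # (x ! 2 + x ! (n - 1)) # drop 3 x)"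

text \<open>The value at dimension 0 is a dummy; the family starts at dimension 1.\<close>

fun spined_cube :: "nat \<Rightarrow> bit list pair_pre_digraph" where
  "spined_cube 0 = \<lparr>pverts = {}, parcs = {}\<rparr>"
| "spined_cube (Suc 0) = \<lparr>pverts = {[0], [1]}, parcs = {([0], [1]), ([1], [0])}\<rparr>"
| "spined_cube (Suc (Suc m)) =
     (let V = pverts (spined_cube (Suc m)); A = parcs (spined_cube (Suc m));
          M = {(0 # u, spine_mate (Suc (Suc m)) (0 # u)) | u. u \<in> V}
      in \<lparr>pverts = Cons 0 ` V \<union> Cons 1 ` V,
          parcs = map_prod (Cons 0) (Cons 0) ` A \<union> map_prod (Cons 1) (Cons 1) ` A \<union> M \<union> M\<inverse>\<rparr>)"

lemma pverts_spined_cube: "pverts (spined_cube (Suc m)) = {x. length x = Suc m}"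
proof (induction m)
  case 0
  show ?case by (auto simp: length_Suc_conv)
next
  case (Suc m)
  have "x \<in> Cons 0 ` {x. length x = Suc m} \<union> Cons 1 ` {x. length x = Suc m}"
    if "length x = Suc (Suc m)" for x :: "bit list"
    using that by (cases x; cases "hd x") auto
  with Suc show ?case by (auto simp: Let_def)
qed

lemma length_spine_mate:
  assumes "length x = n" "2 \<le> n"
  shows "length (spine_mate n x) = n"
  using assms by (auto simp: spine_mate_def)

lemma hd_spine_mate: "\<exists>y. spine_mate n x = 1 # y"
  by (auto simp: spine_mate_def)

lemma pair_graph_spined_cube: "pair_graph (spined_cube n)"
proof (induction n rule: spined_cube.induct)
  case 1
  show ?case by unfold_locales (auto simp: symmetric_def sym_def)
next
  case 2
  show ?case by unfold_locales (auto simp: symmetric_def sym_def)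
next
  case (3 m)
  interpret G: pair_graph "spined_cube (Suc m)" by (rule 3)
  have mate: "\<exists>y. spine_mate (Suc (Suc m)) (0 # u) = 1 # y \<and> y \<in> pverts (spined_cube (Suc m))"
    if "u \<in> pverts (spined_cube (Suc m))" for u
    using that hd_spine_mate[of "Suc (Suc m)" "0 # u"] length_spine_mate[of "0 # u" "Suc (Suc m)"]
    by (auto simp: pverts_spined_cube)
  have sym: "(v, u) \<in> parcs (spined_cube (Suc m))" if "(u, v) \<in> parcs (spined_cube (Suc m))" for u v
    using that G.pair_sym_arcs by (auto simp: symmetric_def sym_def)
  show ?case
  proof unfold_locales
    show "finite (pverts (spined_cube (Suc (Suc m))))"
      using G.pair_finite_verts by (auto simp: Let_def)
    show "finite (parcs (spined_cube (Suc (Suc m))))"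
      using G.pair_finite_verts G.pair_finite_arcs by (auto simp: Let_def)
    show "symmetric (with_proj (spined_cube (Suc (Suc m))))"
      by (auto simp: symmetric_def sym_def Let_def dest: sym intro: rev_image_eqI)
  next
    fix e assume "e \<in> parcs (spined_cube (Suc (Suc m)))"
    then show "fst e \<in> pverts (spined_cube (Suc (Suc m)))"
      and "snd e \<in> pverts (spined_cube (Suc (Suc m)))"
      and "fst e \<noteq> snd e"
      by (auto simp: Let_def dest: mate G.in_arcsD1 G.in_arcsD2 G.pair_no_loops)
  qed
qed

context pair_pre_digraph
begin

text \<open>
  The library's \<^const>\<open>pre_digraph.cycle\<close> is the directed notion, which in a symmetric digraph admits
  the closed walk \<open>u, v, u\<close> along a single edge; the length bound excludes it. Every vertex of a
  closed walk is the tail of one of its arcs.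
\<close>

definition hamiltonian_cycle :: "('a \<times> 'a) awalk \<Rightarrow> bool" where
  "hamiltonian_cycle p \<longleftrightarrow> cycle p \<and> 3 \<le> length p \<and> fst ` set p = pverts G"

end

definition walk_edges :: "('a \<times> 'a) awalk \<Rightarrow> 'a set set" where
  "walk_edges p = (\<lambda>(u, v). {u, v}) ` set p"

definition edge_disjoint :: "('a \<times> 'a) awalk \<Rightarrow> ('a \<times> 'a) awalk \<Rightarrow> bool" where
  "edge_disjoint p q \<longleftrightarrow> walk_edges p \<inter> walk_edges q = {}"

end

theory Submission
  imports Defs
begin

text \<open>
  The construction is uniform in the dimension and gives two edge-disjoint Hamiltonian cycles of
  $SQ_n$ for every $n \ge 4$. An edge joining two strings that first differ at the $k$-th
  position from the right is said to have dimension $k$. Every vertex has exactly one edge of each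
  dimension, so a walk is described by its starting point and a word of dimensions.

  Start from a word $w$ of length 15 that traverses $SQ_4$ and double it as for a Gray code:
  $G_4 = w$ and $G_{n+1} = G_n\,(n+1)\,G_n$. Walking $G_{n+1}$ means walking $G_n$ in one copy of
  $SQ_n$, crossing to the other copy, and walking $G_n$ there, so Hamiltonian paths of $SQ_n$ give a
  Hamiltonian path of $SQ_{n+1}$. The point is to see that the path closes up. Among strings
  with last bit 0, the crossing of the highest dimension only flips $x_1$ and, if $n \ge 5$, adds
  $x_{n-1}$ to $x_2$. Two consecutive crossings therefore commute on the part of
  the string on which both act, and it follows by induction that walking all of $G_n$ has the same
  effect as the single crossing of dimension $n$. One more step of dimension $n$ closes the cycle.

  All these crossings also preserve the last three bits. Start one cycle at a string ending in 000
  and the other at one ending in 010. Then the edges of dimension at least 5 join strings ending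
  in 000 in the first cycle and strings ending in 010 in the second, so none is shared.
  The remaining edges lie inside copies of $SQ_4$, and each such copy is traversed by $w$
  from one of two possible starting points. What is left is a check in $SQ_4$ for two concrete
  words: the transition word of the reflected Gray code with dimensions 1 and 2 exchanged, and
  a companion. The lemmas that carry the argument are \<open>cross_commute\<close>, \<open>sweeps_Suc\<close>,
  \<open>local_or_tail_tour\<close> and \<open>blocks_disjoint\<close>.
\<close>

section \<open>Edges by dimension\<close>

text \<open>
  The neighbour of a string along dimension \<open>k\<close>: only the last \<open>k\<close> bits take part, and their first bit
  flips. Since \<^const>\<open>spine_mate\<close> does not look at the head of its argument and always
  returns head 1, its tail describes the crossing in either direction. In
  dimension 1 nothing follows the flipped bit.
\<close>

fun cross :: "nat \<Rightarrow> bit list \<Rightarrow> bit list" where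
  "cross k [] = []"
| "cross k (b # u) =
     (if k = Suc (length u) then (b + 1) # (if u = [] then [] else tl (spine_mate k (b # u)))
      else b # cross k u)"

lemma length_cross [simp]: "length (cross k x) = length x"
proof (induction x)
  case (Cons b u)
  then show ?case by (cases u) (auto simp: length_spine_mate)
qed simp

text \<open>
  For \<open>n \<ge> 5\<close> the mate depends on the first three and the last two bits, which are disjoint positions.
\<close>

lemma long_list_cases:
  assumes "5 \<le> length x"
  obtains a b c v p q where "x = a # b # c # v @ [p, q]"
proof -
  obtain a b c r where x: "x = a # b # c # r" and r: "2 \<le> length r"
    using assms by (auto simp: Suc_le_length_iff numeral_eq_Suc)
  then have "r \<noteq> []" "butlast r \<noteq> []" by (auto simp flip: length_greater_0_conv)
  then have "r = butlast (butlast r) @ [last (butlast r), last r]"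
    by (metis append_butlast_last_id append.assoc append_Cons append_Nil)
  with x that show ?thesis by metis
qed

lemma bit_add_cancel [simp]: "(a::bit) + b + b = a" by (cases b) simp_all

lemma tl_spine_mate_long:
  "tl (spine_mate (5 + length v) (a # b # c # v @ [p, q])) = (b + p) # (c + q) # v @ [p, q]"
  by (auto simp: spine_mate_def nth_append nth_Cons' numeral_eq_Suc)

text \<open>
  The bits that are added are not changed themselves, so adding them twice restores the string.
  Hence crossing from the copy with prefix 1 back to the copy with prefix 0 uses the same formula.
\<close>

lemma spine_mate_involution:
  assumes "length x = n" "2 \<le> n"
  shows "spine_mate n (b # tl (spine_mate n x)) = 1 # tl x"
proof -
  consider "n = 2" | "n = 3" | "n = 4" | "5 \<le> n" using assms by linarith
  then show ?thesis
  proof cases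
    case 4
    with assms obtain a d c v p q where x: "x = a # d # c # v @ [p, q]"
      by (metis long_list_cases)
    with assms have n: "n = 5 + length v" by simp
    have *: "spine_mate n y = 1 # tl (spine_mate n y)" for y by (metis hd_spine_mate list.sel(3))
    show ?thesis unfolding x n
      by (subst *[unfolded n]) (cases d; cases p; cases c; cases q; simp add: tl_spine_mate_long)
  qed (use assms in \<open>auto simp: spine_mate_def numeral_eq_Suc length_Suc_conv\<close>)
qed

lemma cross_in_parcs:
  assumes "1 \<le> k" "k \<le> length x"
  shows "(x, cross k x) \<in> parcs (spined_cube (length x))"
  using assms
proof (induction x)
  case (Cons b u)
  show ?case
  proof (cases u)
    case Nil
    with Cons.prems show ?thesis by (cases b) auto
  next
    case (Cons c v)
    let ?m = "length v"
    show ?thesis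
    proof (cases "k = Suc (length u)")
      case False
      with Cons.IH Cons.prems Cons show ?thesis by (cases b) (force simp: Let_def)+
    next
      case True
      let ?y = "tl (spine_mate (Suc (Suc ?m)) (b # u))"
      have mate: "spine_mate (Suc (Suc ?m)) z = 1 # tl (spine_mate (Suc (Suc ?m)) z)" for z
        by (metis hd_spine_mate list.sel(3))
      have y: "cross k (b # u) = (b + 1) # ?y" and len: "length ?y = Suc ?m"
        using True Cons by (simp_all add: length_spine_mate)
      have u: "u \<in> {x. length x = Suc ?m}" and V: "?y \<in> {x. length x = Suc ?m}"
        using Cons len by simp_all
      consider "b = 0" | "b = 1" by (cases b)
      then show ?thesis
      proof cases
        case 1
        have "(0 # u, 1 # ?y) = (0 # u, spine_mate (Suc (Suc ?m)) (0 # u))"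
          using mate[of "0 # u"] 1 by simp
        with y 1 u Cons show ?thesis
          unfolding Cons by (auto simp: Let_def simp flip: pverts_spined_cube)
      next
        case 2
        have "spine_mate (Suc (Suc ?m)) (0 # ?y) = 1 # u"
          using spine_mate_involution[of "b # u" "Suc (Suc ?m)" 0] Cons by simp
        with y 2 V Cons show ?thesis
          unfolding Cons by (auto simp: Let_def simp flip: pverts_spined_cube)
      qed
    qed
  qed
qed simp

section \<open>Walks described by words of dimensions\<close>

primrec trace :: "bit list \<Rightarrow> nat list \<Rightarrow> (bit list \<times> bit list) list" where
  "trace x [] = []"
| "trace x (k # ks) = (x, cross k x) # trace (cross k x) ks"

lemma length_trace [simp]: "length (trace x ks) = length ks"
  by (induction ks arbitrary: x) auto

lemma trace_append: "trace x (ks @ ls) = trace x ks @ trace (fold cross ks x) ls"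
  by (induction ks arbitrary: x) auto

lemma length_fst_trace: "y \<in> fst ` set (trace x ks) \<Longrightarrow> length y = length x"
  by (induction ks arbitrary: x) (auto, metis fst_conv image_eqI length_cross)

lemma trace_Cons_bit:
  assumes "\<forall>k\<in>set ks. k \<le> length u"
  shows "trace (b # u) ks = map (map_prod (Cons b) (Cons b)) (trace u ks)"
  using assms by (induction ks arbitrary: u) auto

lemma fold_cross_Cons_bit:
  assumes "\<forall>k\<in>set ks. k \<le> length u"
  shows "fold cross ks (b # u) = b # fold cross ks u"
  using assms by (induction ks arbitrary: u) auto

text \<open>
  A closed walk with $2^n$ steps and no repeated vertex meets all of the $2^n$ vertices by
  counting, so distinctness and closedness are all that has to be verified for a word.
\<close>

lemma hamiltonian_cycle_trace:
  assumes len: "length x = n" "2 \<le> n" "length ks = 2 ^ n"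
    and ks: "\<forall>k\<in>set ks. 1 \<le> k \<and> k \<le> n"
    and closed: "fold cross ks x = x"
    and dist: "distinct (map fst (trace x ks))"
  shows "pair_pre_digraph.hamiltonian_cycle (spined_cube n) (trace x ks)"
proof -
  interpret G: pair_graph "spined_cube n" by (rule pair_graph_spined_cube)
  have verts: "pverts (spined_cube n) = {z. length z = n}"
    using pverts_spined_cube[of "n - 1"] len by simp
  have arcs: "set (trace z ls) \<subseteq> parcs (spined_cube n)"
    if "length z = n" "set ls \<subseteq> set ks" for z ls
    using that
  proof (induction ls arbitrary: z)
    case (Cons k ls)
    then have "(z, cross k z) \<in> parcs (spined_cube n)"
      using ks cross_in_parcs[of k z] by auto
    with Cons show ?case by simp
  qed simp
  have cas: "G.cas z (trace z ls) (fold cross ls z)" for z ls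
    by (induction ls arbitrary: z) auto
  \<comment> \<open>The hypothesis \<open>2 \<le> n\<close> excludes the walk \<open>u, v, u\<close> along the only edge of the graph for \<open>n = 1\<close>.\<close>
  have "(2::nat) ^ 2 \<le> 2 ^ n" using len by (intro power_increasing) auto
  then have ge: "4 \<le> length (trace x ks)" using len by simp
  then have ne: "trace x ks \<noteq> []" by (cases "trace x ks") simp_all
  have walk: "G.awalk x (trace x ks) x"
    using arcs[of x ks] cas[of x ks] closed len verts by (simp add: G.awalk_def)
  have verts_trace: "G.awalk_verts z (trace z ls) = map fst (trace z ls) @ [fold cross ls z]" for z ls
    by (induction ls arbitrary: z) auto
  obtain k ls where "ks = k # ls" using ne by (cases ks) auto
  then have "distinct (tl (G.awalk_verts x (trace x ks)))"
    using dist unfolding verts_trace closed by auto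
  with walk ne have "G.cycle (trace x ks)"
    unfolding G.cycle_def by blast
  moreover have "fst ` set (trace x ks) = pverts (spined_cube n)"
  proof (rule card_subset_eq)
    show "finite (pverts (spined_cube n))" by (rule G.pair_finite_verts)
    show "fst ` set (trace x ks) \<subseteq> pverts (spined_cube n)"
      using length_fst_trace[of _ x ks] len verts by auto
    have "card (fst ` set (trace x ks)) = 2 ^ n"
      using distinct_card[OF dist] len by simp
    moreover have "card {z :: bit list. length z = n} = 2 ^ n"
    proof -
      have bits: "(UNIV :: bit set) = {0, 1}" by (auto intro: bit.exhaust)
      have "finite (UNIV :: bit set)" "card (UNIV :: bit set) = 2" unfolding bits by simp_all
      then show ?thesis
        using card_lists_length_eq[of "UNIV :: bit set" n] by simp
    qed
    ultimately show "card (fst ` set (trace x ks)) = card (pverts (spined_cube n))"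
      using verts by simp
  qed
  ultimately show ?thesis
    using ge by (auto simp: G.hamiltonian_cycle_def)
qed

section \<open>The highest crossing on strings with last bit 0\<close>

text \<open>
  The effect of the highest crossing on \<open>y\<close>, the bits after the first and before the last
  three, when the last three bits are \<open>0, p, 0\<close>.
\<close>

fun twist :: "bit \<Rightarrow> bit list \<Rightarrow> bit list" where
  "twist p [] = []"
| "twist p (d # y) = (d + p) # y"

lemma length_twist [simp]: "length (twist p y) = length y" by (cases y) auto

lemma twist_twist [simp]: "twist p (twist p y) = y" by (cases y) auto

text \<open>
  In a string ending in \<open>p, 0\<close>, a crossing of dimension at least 5 adds \<open>p\<close> to the second bit and 0
  to the third, and a crossing of dimension 4 adds 0 to the second bit. Both cases have the same
  form, the latter because \<open>twist\<close> has no bit left to act on.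
\<close>

lemma cross_top:
  "cross (4 + length y) (a # y @ [0, p, 0]) = (a + 1) # twist p y @ [0, p, 0]"
proof (cases y)
  case Nil
  then show ?thesis by (simp add: spine_mate_def)
next
  case (Cons d z)
  show ?thesis
  proof (cases z)
    case Nil
    with Cons show ?thesis by (simp add: spine_mate_def)
  next
    case (Cons c v)
    then show ?thesis
      using \<open>y = d # z\<close> tl_spine_mate_long[of "v @ [0]" a d c p 0] by (simp add: add_ac)
  qed
qed

section \<open>Doubling a traversal\<close>

fun tour :: "nat list \<Rightarrow> nat \<Rightarrow> nat list" where
  "tour w 0 = w"
| "tour w (Suc m) = tour w m @ (5 + m) # tour w m"

lemma tour_labels:
  assumes "\<forall>k\<in>set w. 1 \<le> k \<and> k \<le> 4" "k \<in> set (tour w m)"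
  shows "1 \<le> k \<and> k \<le> 4 + m"
  using assms(2) by (induction m) (use assms(1) in auto)

lemma length_tour: "length w = 15 \<Longrightarrow> Suc (length (tour w m)) = 2 ^ (4 + m)"
  by (induction m) (auto simp: power_add)

text \<open>
  The induction invariant: from each start with the prescribed last three bits, the walk
  repeats no vertex and has the net effect of one crossing of the highest dimension. The
  appended dimension \<open>4 + m\<close> makes the end of the walk the tail of an arc, so that it is
  listed among the visited vertices too.
\<close>

definition sweeps :: "bit \<Rightarrow> nat list \<Rightarrow> nat \<Rightarrow> bool" where
  "sweeps p ks m \<longleftrightarrow> (\<forall>y. length y = Suc m \<longrightarrow>
     fold cross ks (y @ [0, p, 0]) = cross (4 + m) (y @ [0, p, 0]) \<and>
     distinct (map fst (trace (y @ [0, p, 0]) (ks @ [4 + m]))))"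

text \<open>
  Why doubled walks close up: write \<open>K\<close> for the crossing of dimension \<open>n = 4 + m\<close> and \<open>L\<close> for the
  change that the crossing of dimension \<open>n + 1\<close> makes to the last \<open>n\<close> bits. Both add constants
  to single bits, so they commute and \<open>K L K = L\<close>. Here \<open>y'\<close> is the string after the first \<open>K\<close>,
  and \<open>z\<close> the one after \<open>L\<close>, where the second half of a doubled walk begins.
\<close>

lemma cross_commute:
  fixes y :: "bit list"
  assumes "length y = Suc m"
  obtains y' z where "length y' = Suc m" "length z = Suc m"
    "cross (4 + m) (y @ [0, p, 0]) = y' @ [0, p, 0]"
    "cross (5 + m) (b # y' @ [0, p, 0]) = (b + 1) # z @ [0, p, 0]"
    "(b + 1) # cross (4 + m) (z @ [0, p, 0]) = cross (5 + m) (b # y @ [0, p, 0])"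
proof -
  obtain a u where y: "y = a # u" "length u = m" using assms by (cases y) auto
  show ?thesis
  proof (rule that[of "(a + 1) # twist p u" "(a + 1 + p) # twist p u"])
    show "cross (4 + m) (y @ [0, p, 0]) = ((a + 1) # twist p u) @ [0, p, 0]"
      using cross_top[of u a p] y by simp
    show "cross (5 + m) (b # ((a + 1) # twist p u) @ [0, p, 0])
        = (b + 1) # ((a + 1 + p) # twist p u) @ [0, p, 0]"
      using cross_top[of "(a + 1) # twist p u" b p] y by (simp del: cross.simps)
    have "a + 1 + p + 1 = a + p" by (cases a; cases p) simp_all
    then show "(b + 1) # cross (4 + m) (((a + 1 + p) # twist p u) @ [0, p, 0])
        = cross (5 + m) (b # y @ [0, p, 0])"
      using cross_top[of "twist p u" "a + 1 + p" p] cross_top[of y b p] y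
      by (simp del: cross.simps)
  qed (use y in auto)
qed

text \<open>
  The two halves of the doubled walk lie in different copies, hence no vertex repeats. By
  induction each half acts as \<open>K\<close>, and the net effect \<open>K L K = L\<close> is the new highest crossing.
\<close>

lemma sweeps_Suc:
  assumes w: "\<forall>k\<in>set w. 1 \<le> k \<and> k \<le> 4" and IH: "sweeps p (tour w m) m"
  shows "sweeps p (tour w (Suc m)) (Suc m)"
  unfolding sweeps_def
proof (intro allI impI)
  fix x :: "bit list" assume "length x = Suc (Suc m)"
  then obtain b y where x: "x = b # y" and y: "length y = Suc m" by (cases x) auto
  obtain y' z where y': "length y' = Suc m" and z: "length z = Suc m"
    and cr: "cross (4 + m) (y @ [0, p, 0]) = y' @ [0, p, 0]"
    "cross (5 + m) (b # y' @ [0, p, 0]) = (b + 1) # z @ [0, p, 0]"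
    "(b + 1) # cross (4 + m) (z @ [0, p, 0]) = cross (5 + m) (b # y @ [0, p, 0])"
    using cross_commute[OF y, of p b] by metis
  let ?t = "[0, p, 0]" and ?w = "tour w m"
  have le: "\<forall>k\<in>set ?w. k \<le> length (v @ ?t)" if "length v = Suc m" for v
    using tour_labels[OF w] that by fastforce
  have P: "fold cross ?w (v @ ?t) = cross (4 + m) (v @ ?t)"
    and D: "distinct (map fst (trace (v @ ?t) (?w @ [4 + m])))" if "length v = Suc m" for v
    using IH that unfolding sweeps_def by blast+
  have lift: "map fst (trace (c # v @ ?t) ?w) = map (Cons c) (map fst (trace (v @ ?t) ?w))"
    "fold cross ?w (c # v @ ?t) = c # cross (4 + m) (v @ ?t)"
    if "length v = Suc m" for v c
    using trace_Cons_bit[OF le[OF that]] fold_cross_Cons_bit[OF le[OF that]] P[OF that] by simp_all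
  \<comment> \<open>The crossing arc supplies the last vertex of the first half.\<close>
  have halves: "map fst (trace (b # y @ ?t) (tour w (Suc m) @ [4 + Suc m]))
      = map (Cons b) (map fst (trace (y @ ?t) (?w @ [4 + m])))
        @ map (Cons (b + 1)) (map fst (trace (z @ ?t) (?w @ [4 + m])))"
    using y y' z cr by (simp add: trace_append lift P del: cross.simps map_map)
  have "b \<noteq> b + 1" by (cases b) simp_all
  then have "distinct (map fst (trace (b # y @ ?t) (tour w (Suc m) @ [4 + Suc m])))"
    unfolding halves distinct_append using D[OF y] D[OF z] by (auto simp: distinct_map inj_on_def simp del: map_map)
  moreover have "fold cross (tour w (Suc m)) (b # y @ ?t) = cross (4 + Suc m) (b # y @ ?t)"
    using y z cr by (simp add: lift del: cross.simps)
  ultimately show "fold cross (tour w (Suc m)) (x @ ?t) = cross (4 + Suc m) (x @ ?t) \<and>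
      distinct (map fst (trace (x @ ?t) (tour w (Suc m) @ [4 + Suc m])))"
    using x by simp
qed

lemma sweeps_tour:
  assumes "\<forall>k\<in>set w. 1 \<le> k \<and> k \<le> 4" "sweeps p w 0"
  shows "sweeps p (tour w m) m"
  by (induction m) (use assms sweeps_Suc[OF assms(1)] in auto)

lemma cross_cross:
  assumes "length y = Suc m"
  shows "cross (4 + m) (cross (4 + m) (y @ [0, p, 0])) = y @ [0, p, 0]"
  using assms cross_top[of "tl y" "hd y" p] cross_top[of "twist p (tl y)" "hd y + 1" p]
  by (cases y) (simp_all del: cross.simps)

lemma hamiltonian_cycle_tour:
  assumes w: "\<forall>k\<in>set w. 1 \<le> k \<and> k \<le> 4" "length w = 15" and base: "sweeps p w 0"
    and y: "length y = Suc m"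
  shows "pair_pre_digraph.hamiltonian_cycle (spined_cube (4 + m))
    (trace (y @ [0, p, 0]) (tour w m @ [4 + m]))"
proof (rule hamiltonian_cycle_trace)
  have "sweeps p (tour w m) m" by (rule sweeps_tour[OF w(1) base])
  then show "fold cross (tour w m @ [4 + m]) (y @ [0, p, 0]) = y @ [0, p, 0]"
    "distinct (map fst (trace (y @ [0, p, 0]) (tour w m @ [4 + m])))"
    using y cross_cross[OF y] by (auto simp: sweeps_def simp del: cross.simps)
  show "\<forall>k\<in>set (tour w m @ [4 + m]). 1 \<le> k \<and> k \<le> 4 + m"
    using tour_labels[OF w(1)] by auto
  show "length (tour w m @ [4 + m]) = 2 ^ (4 + m)"
    using length_tour[OF w(2), of m] by simp
qed (use y in auto)

section \<open>Where the arcs of a doubled walk lie\<close>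

text \<open>
  An arc that leaves the first \<open>m\<close> bits alone has dimension at most 4 and lies in one copy of
  $SQ_4$, where it has to belong to \<open>E\<close>. An arc that changes them has dimension at least 5, and both its ends
  have to carry the last three bits of the starting point.
\<close>

definition local_or_tail ::
  "(bit list \<times> bit list) set \<Rightarrow> bit \<Rightarrow> nat \<Rightarrow> bit list \<times> bit list \<Rightarrow> bool" where
  "local_or_tail E p m e \<longleftrightarrow>
     (if take m (fst e) = take m (snd e) then (drop m (fst e), drop m (snd e)) \<in> E
      else drop (Suc m) (fst e) = [0, p, 0] \<and> drop (Suc m) (snd e) = [0, p, 0])"

text \<open>
  Inside one copy of $SQ_4$ only the first bit of the entry point can vary. The word is closed
  up by a final 4, so that the case \<open>m = 0\<close> of the whole cycle is covered as well.
\<close>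

definition block_arcs :: "bit \<Rightarrow> nat list \<Rightarrow> (bit list \<times> bit list) set" where
  "block_arcs p w = (\<Union>a\<in>{0, 1}. set (trace [a, 0, p, 0] (w @ [4])))"

lemma local_or_tail_Cons:
  "local_or_tail E p (Suc m) (map_prod (Cons b) (Cons b) e) \<longleftrightarrow> local_or_tail E p m e"
  by (cases e) (simp add: local_or_tail_def)

text \<open>
  The arcs of the doubled closed walk are those of its two halves, lifted by one bit, the
  crossing between the halves, and the closing arc. Both halves start with the same last three
  bits, so the induction hypothesis applies to both; the other two arcs change the first bit.
\<close>

lemma local_or_tail_tour:
  assumes w: "\<forall>k\<in>set w. 1 \<le> k \<and> k \<le> 4" and base: "sweeps p w 0"
    and "length y = Suc m" "e \<in> set (trace (y @ [0, p, 0]) (tour w m @ [4 + m]))"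
  shows "local_or_tail (block_arcs p w) p m e"
  using assms(3,4)
proof (induction m arbitrary: y e)
  case 0
  then obtain a where "y = [a]" by (auto simp: length_Suc_conv)
  moreover have "a \<in> {0, 1}" by (cases a) simp_all
  ultimately show ?case
    using 0 by (cases e) (auto simp: local_or_tail_def block_arcs_def simp del: cross.simps)
next
  case (Suc m x e)
  then obtain b y where x: "x = b # y" and y: "length y = Suc m" by (cases x) auto
  obtain y' z where y': "length y' = Suc m" and z: "length z = Suc m"
    and cr: "cross (4 + m) (y @ [0, p, 0]) = y' @ [0, p, 0]"
    "cross (5 + m) (b # y' @ [0, p, 0]) = (b + 1) # z @ [0, p, 0]"
    "(b + 1) # cross (4 + m) (z @ [0, p, 0]) = cross (5 + m) (b # y @ [0, p, 0])"
    using cross_commute[OF y, of p b] by metis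
  let ?t = "[0, p, 0]" and ?w = "tour w m"
  have le: "\<forall>k\<in>set ?w. k \<le> length (v @ ?t)" if "length v = Suc m" for v
    using tour_labels[OF w] that by fastforce
  have P: "fold cross ?w (v @ ?t) = cross (4 + m) (v @ ?t)" if "length v = Suc m" for v
    using sweeps_tour[OF w base] that unfolding sweeps_def by blast
  have lift: "trace (c # v @ ?t) ?w = map (map_prod (Cons c) (Cons c)) (trace (v @ ?t) ?w)"
    "fold cross ?w (c # v @ ?t) = c # cross (4 + m) (v @ ?t)"
    if "length v = Suc m" for v c
    using trace_Cons_bit[OF le[OF that]] fold_cross_Cons_bit[OF le[OF that]] P[OF that] by simp_all
  have top: "cross (5 + m) (b # y @ ?t) = (b + 1) # twist p y @ ?t"
    using cross_top[of y b p] y by simp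
  have return: "cross (5 + m) ((b + 1) # twist p y @ ?t) = b # y @ ?t"
    using cross_top[of "twist p y" "b + 1" p] y by simp
  have "b \<noteq> b + 1" by (cases b) simp_all
  have "trace (b # y @ ?t) (tour w (Suc m) @ [4 + Suc m])
      = map (map_prod (Cons b) (Cons b)) (trace (y @ ?t) ?w)
        @ (b # y' @ ?t, (b + 1) # z @ ?t)
        # map (map_prod (Cons (b + 1)) (Cons (b + 1))) (trace (z @ ?t) ?w)
        @ [((b + 1) # twist p y @ ?t, b # y @ ?t)]"
    using y z cr top return by (simp add: trace_append lift del: cross.simps)
  with Suc.prems x consider
    e' where "e' \<in> set (trace (y @ ?t) ?w)" "e = map_prod (Cons b) (Cons b) e'"
    | e' where "e' \<in> set (trace (z @ ?t) ?w)" "e = map_prod (Cons (b + 1)) (Cons (b + 1)) e'"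
    | "e = (b # y' @ ?t, (b + 1) # z @ ?t)" | "e = ((b + 1) # twist p y @ ?t, b # y @ ?t)"
    by auto
  then show ?case
  proof cases
    case 1
    then show ?thesis using Suc.IH[OF y, of e'] by (simp add: local_or_tail_Cons trace_append)
  next
    case 2
    then show ?thesis using Suc.IH[OF z, of e'] by (simp add: local_or_tail_Cons trace_append)
  qed (use y z y' \<open>b \<noteq> b + 1\<close> in \<open>auto simp: local_or_tail_def\<close>)
qed

section \<open>Two words in dimension 4\<close>

definition gray4 :: "nat list" where
  "gray4 = [2,1,2,3,2,1,2, 4, 2,1,2,3,2,1,2]"

text \<open>
  The companion, found by search, has the same shape \<open>u 4 u\<close> with a palindrome \<open>u\<close>. Starts at strings
  ending in \<open>0, 1, 0\<close> are singled out not only to keep the two cycles apart: from \<open>[0, 0, 0, 1]\<close>, for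
  instance, this word does not visit all vertices.
\<close>

definition partner4 :: "nat list" where
  "partner4 = [3,1,4,3,4,1,3, 4, 3,1,4,3,4,1,3]"

lemma sweeps_gray4: "sweeps 0 gray4 0"
proof -
  have "fold cross gray4 [a, 0, 0, 0] = cross 4 [a, 0, 0, 0] \<and>
      distinct (map fst (trace [a, 0, 0, 0] (gray4 @ [4])))" for a
    by (cases a) (simp_all add: gray4_def spine_mate_def)
  then show ?thesis by (auto simp: sweeps_def length_Suc_conv simp del: cross.simps)
qed

lemma sweeps_partner4: "sweeps 1 partner4 0"
proof -
  have "fold cross partner4 [a, 0, 1, 0] = cross 4 [a, 0, 1, 0] \<and>
      distinct (map fst (trace [a, 0, 1, 0] (partner4 @ [4])))" for a
    by (cases a) (simp_all add: partner4_def spine_mate_def)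
  then show ?thesis by (auto simp: sweeps_def length_Suc_conv simp del: cross.simps)
qed

lemma blocks_disjoint:
  "block_arcs 0 gray4 \<inter> block_arcs 1 partner4 = {}"
  "block_arcs 0 gray4 \<inter> prod.swap ` block_arcs 1 partner4 = {}"
  by (simp_all add: block_arcs_def gray4_def partner4_def spine_mate_def)

section \<open>Two edge-disjoint Hamiltonian cycles\<close>

lemma edge_disjointI:
  assumes "set p \<inter> set q = {}" "set p \<inter> prod.swap ` set q = {}"
  shows "edge_disjoint p q"
proof -
  have False if "(a, b) \<in> set p" "(c, d) \<in> set q" "{a, b} = {c, d}" for a b c d
  proof -
    from that(3) have "(c, d) = (a, b) \<or> prod.swap (c, d) = (a, b)" by (auto simp: doubleton_eq_iff)
    then show False using that(1,2) assms by (metis IntI empty_iff imageI)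
  qed
  then show ?thesis
    unfolding edge_disjoint_def walk_edges_def by fast
qed

text \<open>
  Changing or not changing the first \<open>m\<close> bits is a property of the arc alone, so a shared arc is
  local in both walks, against \<open>E \<inter> F = {}\<close>, or in neither, against the different last bits.
\<close>

lemma local_or_tail_clash:
  assumes "local_or_tail E p m e" "local_or_tail F q m e" "E \<inter> F = {}" "p \<noteq> q"
  shows False
  using assms by (auto simp: local_or_tail_def split: if_splits)

lemma local_or_tail_swap:
  "local_or_tail E p m e \<Longrightarrow> local_or_tail (prod.swap ` E) p m (prod.swap e)"
  by (cases e) (force simp: local_or_tail_def split: if_splits)

theorem two_edge_disjoint_hamiltonian_cycles:
  fixes m :: nat
  shows "\<exists>C D. pair_pre_digraph.hamiltonian_cycle (spined_cube (4 + m)) C \<and>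
               pair_pre_digraph.hamiltonian_cycle (spined_cube (4 + m)) D \<and>
               edge_disjoint C D"
proof (intro exI conjI)
  let ?y = "replicate (Suc m) (0 :: bit)"
  let ?C = "trace (?y @ [0, 0, 0]) (tour gray4 m @ [4 + m])"
  let ?D = "trace (?y @ [0, 1, 0]) (tour partner4 m @ [4 + m])"
  have labels: "\<forall>k\<in>set gray4. 1 \<le> k \<and> k \<le> 4" "\<forall>k\<in>set partner4. 1 \<le> k \<and> k \<le> 4"
    and len: "length gray4 = 15" "length partner4 = 15"
    by (simp_all add: gray4_def partner4_def)
  show "pair_pre_digraph.hamiltonian_cycle (spined_cube (4 + m)) ?C"
    by (rule hamiltonian_cycle_tour[OF labels(1) len(1) sweeps_gray4]) simp
  show "pair_pre_digraph.hamiltonian_cycle (spined_cube (4 + m)) ?D"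
    by (rule hamiltonian_cycle_tour[OF labels(2) len(2) sweeps_partner4]) simp
  have C: "local_or_tail (block_arcs 0 gray4) 0 m e" if "e \<in> set ?C" for e
    by (rule local_or_tail_tour[OF labels(1) sweeps_gray4 _ that]) simp
  have D: "local_or_tail (block_arcs 1 partner4) 1 m e" if "e \<in> set ?D" for e
    by (rule local_or_tail_tour[OF labels(2) sweeps_partner4 _ that]) simp
  show "edge_disjoint ?C ?D"
  proof (rule edge_disjointI)
    show "set ?C \<inter> set ?D = {}"
      using local_or_tail_clash[OF C D blocks_disjoint(1)] by auto
    show "set ?C \<inter> prod.swap ` set ?D = {}"
      using local_or_tail_clash[OF C local_or_tail_swap[OF D] blocks_disjoint(2)] by auto
  qed
qed

theorem theorem4p1:
  fixes n :: nat
  assumes "4 \<le> n" and "n \<le> 6"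
  shows "\<exists>C D. pair_pre_digraph.hamiltonian_cycle (spined_cube n) C \<and>
               pair_pre_digraph.hamiltonian_cycle (spined_cube n) D \<and>
               edge_disjoint C D"
  using two_edge_disjoint_hamiltonian_cycles[of "n - 4"] assms(1) by simp

end
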